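(* Let $x_1, \ldots, x_n \in \mathbb{R}^d$ be discrete probability distributions over a domain of $d$ elements and let $A$ be the $n \times n$ matrix with $A_{i,j} = \mathrm{TV}(x_i, x_j)$. Then one can compute $Ay$ for any query $y \in \mathbb{R}^n$ exactly, using $O(nd \log n)$ preprocessing time (independent of $y$) and $O(nd)$ query time.
   Context: $\mathrm{TV}(x,y) = \frac{1}{2}\sum_{k=1}^d |x(k) - y(k)|$ is the total variation distance, where $x(k)$ is the $k$th coordinate of $x$. *)

theory Defs
  imports "Jordan_Normal_Form.Matrix" "HOL.Transcendental"
begin

section \<open>Total variation distance matrices\<close>

definition prob_vec :: "nat \<Rightarrow> real vec \<Rightarrow> bool" where
  "prob_vec d p \<longleftrightarrow> p \<in> carrier_vec d \<and> (\<forall>k<d. 0 \<le> p $ k) \<and> (\<Sum>k<d. p $ k) = 1"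

definition tv :: "real vec \<Rightarrow> real vec \<Rightarrow> real" where
  "tv p q = 1 / 2 * (\<Sum>k<dim_vec p. \<bar>p $ k - q $ k\<bar>)"

definition tv_matrix :: "nat \<Rightarrow> (nat \<Rightarrow> real vec) \<Rightarrow> real mat" where
  "tv_matrix n x = mat n n (\<lambda>(i, j). tv (x i) (x j))"

section \<open>A real RAM\<close>

text \<open>
  Running time is measured on a real RAM with unit-cost exact real arithmetic (no rounding, no
  floor, no conversion between reals and integers) and unit-cost real comparison, given as a
  structured while-language.  As in the unit-cost RAM of Cook and Reckhow, natural numbers
  have only addition and truncated subtraction, so that no computation can be hidden in large
  integers.  A program uses finitely many names, each denoting an unbounded array of naturals
  and, separately, one of reals; a scalar variable is cell 0 of an array.
\<close>

record store =
  nmem :: "string \<Rightarrow> nat \<Rightarrow> nat"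
  rmem :: "string \<Rightarrow> nat \<Rightarrow> real"

datatype nexp =
    NConst nat
  | NGet string nexp
  | NAdd nexp nexp
  | NSub nexp nexp

datatype rexp =
    RConst int
  | RGet string nexp
  | RAdd rexp rexp
  | RSub rexp rexp
  | RMul rexp rexp
  | RDiv rexp rexp

datatype bexp =
    NLess nexp nexp
  | RLess rexp rexp
  | Neg bexp
  | Conj bexp bexp

datatype com =
    Skip
  | NSet string nexp nexp
  | RSet string nexp rexp
  | Seq com com
  | Cond bexp com com
  | While bexp com

primrec nval :: "nexp \<Rightarrow> store \<Rightarrow> nat" where
  "nval (NConst c) s = c"
| "nval (NGet a e) s = nmem s a (nval e s)"
| "nval (NAdd e f) s = nval e s + nval f s"
| "nval (NSub e f) s = nval e s - nval f s"

primrec rval :: "rexp \<Rightarrow> store \<Rightarrow> real" where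
  "rval (RConst c) s = of_int c"
| "rval (RGet a e) s = rmem s a (nval e s)"
| "rval (RAdd e f) s = rval e s + rval f s"
| "rval (RSub e f) s = rval e s - rval f s"
| "rval (RMul e f) s = rval e s * rval f s"
| "rval (RDiv e f) s = rval e s / rval f s"

primrec bval :: "bexp \<Rightarrow> store \<Rightarrow> bool" where
  "bval (NLess e f) s \<longleftrightarrow> nval e s < nval f s"
| "bval (RLess e f) s \<longleftrightarrow> rval e s < rval f s"
| "bval (Neg b) s \<longleftrightarrow> \<not> bval b s"
| "bval (Conj b c) s \<longleftrightarrow> bval b s \<and> bval c s"

primrec ncost :: "nexp \<Rightarrow> nat" where
  "ncost (NConst c) = 1"
| "ncost (NGet a e) = 1 + ncost e"
| "ncost (NAdd e f) = 1 + ncost e + ncost f"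
| "ncost (NSub e f) = 1 + ncost e + ncost f"

primrec rcost :: "rexp \<Rightarrow> nat" where
  "rcost (RConst c) = 1"
| "rcost (RGet a e) = 1 + ncost e"
| "rcost (RAdd e f) = 1 + rcost e + rcost f"
| "rcost (RSub e f) = 1 + rcost e + rcost f"
| "rcost (RMul e f) = 1 + rcost e + rcost f"
| "rcost (RDiv e f) = 1 + rcost e + rcost f"

primrec bcost :: "bexp \<Rightarrow> nat" where
  "bcost (NLess e f) = 1 + ncost e + ncost f"
| "bcost (RLess e f) = 1 + rcost e + rcost f"
| "bcost (Neg b) = 1 + bcost b"
| "bcost (Conj b c) = 1 + bcost b + bcost c"

definition nwrite :: "string \<Rightarrow> nat \<Rightarrow> nat \<Rightarrow> store \<Rightarrow> store" where
  "nwrite a i v s = s\<lparr>nmem := (nmem s)(a := (nmem s a)(i := v))\<rparr>"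

definition rwrite :: "string \<Rightarrow> nat \<Rightarrow> real \<Rightarrow> store \<Rightarrow> store" where
  "rwrite a i v s = s\<lparr>rmem := (rmem s)(a := (rmem s a)(i := v))\<rparr>"

text \<open>\<open>exec c s t s'\<close>: started in \<open>s\<close>, the program \<open>c\<close> halts in \<open>s'\<close> after exactly \<open>t\<close> steps.\<close>

inductive exec :: "com \<Rightarrow> store \<Rightarrow> nat \<Rightarrow> store \<Rightarrow> bool" where
  Skip: "exec Skip s 1 s"
| NSet: "exec (NSet a e f) s (1 + ncost e + ncost f) (nwrite a (nval e s) (nval f s) s)"
| RSet: "exec (RSet a e f) s (1 + ncost e + rcost f) (rwrite a (nval e s) (rval f s) s)"
| Seq: "exec c s t s' \<Longrightarrow> exec c' s' t' s'' \<Longrightarrow> exec (Seq c c') s (t + t') s''"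
| CondT: "bval b s \<Longrightarrow> exec c s t s' \<Longrightarrow> exec (Cond b c c') s (1 + bcost b + t) s'"
| CondF: "\<not> bval b s \<Longrightarrow> exec c' s t s' \<Longrightarrow> exec (Cond b c c') s (1 + bcost b + t) s'"
| WhileF: "\<not> bval b s \<Longrightarrow> exec (While b c) s (1 + bcost b) s"
| WhileT: "bval b s \<Longrightarrow> exec c s t s' \<Longrightarrow> exec (While b c) s' t' s'' \<Longrightarrow>
    exec (While b c) s (1 + bcost b + t + t') s''"

lemma exec_deterministic:
  "exec c s t s' \<Longrightarrow> exec c s u s'' \<Longrightarrow> u = t \<and> s'' = s'"
proof (induction arbitrary: u s'' rule: exec.induct)
  case (Skip s)
  from Skip.prems show ?case by cases simp_all
next
  case (NSet a e f s)
  from NSet.prems show ?case by cases simp_all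
next
  case (RSet a e f s)
  from RSet.prems show ?case by cases simp_all
next
  case (Seq c s t s1 c' t' s2)
  from Seq.prems show ?case by cases (metis Seq.IH)
next
  case (CondT b s c t s1 c')
  from CondT.prems obtain r where "u = 1 + bcost b + r" "exec c s r s''"
    by cases (simp_all add: CondT.hyps)
  then show ?case using CondT.IH by simp
next
  case (CondF b s c' t s1 c)
  from CondF.prems obtain r where "u = 1 + bcost b + r" "exec c' s r s''"
    by cases (simp_all add: CondF.hyps)
  then show ?case using CondF.IH by simp
next
  case (WhileF b s c)
  from WhileF.prems show ?case by cases (simp_all add: WhileF.hyps)
next
  case (WhileT b s c t s1 t' s2)
  from WhileT.prems obtain r r' s3
    where r: "u = 1 + bcost b + r + r'" "exec c s r s3" "exec (While b c) s3 r' s''"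
    by cases (simp_all add: WhileT.hyps)
  moreover have "r = t \<and> s3 = s1" using WhileT.IH(1) r(2) .
  ultimately show ?case using WhileT.IH(2) by simp
qed

section \<open>Input, queries and output\<close>

text \<open>
  The distributions are stored row by row in the real array \<open>x\<close>, and their number and the size
  of the domain in the natural number variables \<open>n\<close> and \<open>d\<close>; all other memory is zero.
\<close>

definition input_store :: "nat \<Rightarrow> nat \<Rightarrow> (nat \<Rightarrow> real vec) \<Rightarrow> store" where
  "input_store n d x = \<lparr>
     nmem = (\<lambda>_ _. 0)(''n'' := (\<lambda>_. 0)(0 := n), ''d'' := (\<lambda>_. 0)(0 := d)),
     rmem = (\<lambda>_ _. 0)(''x'' := (\<lambda>a. if a < n * d then x (a div d) $ (a mod d) else 0))\<rparr>"

definition load_query :: "real vec \<Rightarrow> store \<Rightarrow> store" where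
  "load_query y s = s\<lparr>rmem := (rmem s)
     (''y'' := (\<lambda>i. if i < dim_vec y then y $ i else rmem s ''y'' i))\<rparr>"

definition output_vec :: "nat \<Rightarrow> store \<Rightarrow> real vec" where
  "output_vec n s = vec n (rmem s ''out'')"

text \<open>
  The memory contents possible after finitely many queries of dimension \<open>n\<close> have been answered
  one after the other, without restoring the memory in between.
\<close>

inductive after_queries :: "com \<Rightarrow> nat \<Rightarrow> store \<Rightarrow> store \<Rightarrow> bool" for query n s\<^sub>0 where
  none: "after_queries query n s\<^sub>0 s\<^sub>0"
| more: "after_queries query n s\<^sub>0 s \<Longrightarrow> y \<in> carrier_vec n \<Longrightarrow>
    exec query (load_query y s) t s' \<Longrightarrow> after_queries query n s\<^sub>0 s'"

end

theory Submission imports Defs begin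

text \<open>
  Because all \<open>x i\<close> have the same coordinate sum, \<open>tv (x i) (x j) = (\<Sum>k<d. max 0 (x i $ k - x j $ k))\<close>.
  Hence, if the coordinates \<open>x i $ k\<close> are sorted for fixed \<open>k\<close>, only the indices \<open>j\<close> that precede \<open>i\<close>
  contribute to the \<open>k\<close>-th part of the \<open>i\<close>-th output, which is \<open>x i $ k * Y - V\<close> for the prefix sums
  \<open>Y\<close> of \<open>y $ j\<close> and \<open>V\<close> of \<open>x j $ k * y $ j\<close>.  One scan of each sorted column therefore answers a
  query.  The preprocessing sorts each column by bottom-up merge sort, which needs no multiplication
  or division of naturals, only doubling of the block width.
\<close>

section \<open>Reasoning about programs\<close>

text \<open>Total correctness, with the exact step count passed to \<open>Q\<close>. As programs are
  deterministic, the existential speaks of the only run, which makes the rules below equivalences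
  fit for rewriting.\<close>

definition runs :: "com \<Rightarrow> store \<Rightarrow> (nat \<Rightarrow> store \<Rightarrow> bool) \<Rightarrow> bool" where
  "runs c s Q \<longleftrightarrow> (\<exists>t s'. exec c s t s' \<and> Q t s')"

lemma runs_mono: "runs c s Q \<Longrightarrow> (\<And>t s'. Q t s' \<Longrightarrow> Q' t s') \<Longrightarrow> runs c s Q'"
  unfolding runs_def by blast

lemma runs_Skip [simp]: "runs Skip s Q \<longleftrightarrow> Q 1 s"
  unfolding runs_def by (metis exec.Skip exec_deterministic)

lemma runs_NSet [simp]:
  "runs (NSet a e f) s Q \<longleftrightarrow> Q (1 + ncost e + ncost f) (nwrite a (nval e s) (nval f s) s)"
  unfolding runs_def by (metis exec.NSet exec_deterministic)

lemma runs_RSet [simp]: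
  "runs (RSet a e f) s Q \<longleftrightarrow> Q (1 + ncost e + rcost f) (rwrite a (nval e s) (rval f s) s)"
  unfolding runs_def by (metis exec.RSet exec_deterministic)

lemma runs_Seq [simp]:
  "runs (Seq c c') s Q \<longleftrightarrow> runs c s (\<lambda>t s'. runs c' s' (\<lambda>t' s''. Q (t + t') s''))"
proof
  assume "runs (Seq c c') s Q"
  then obtain t s' where "exec (Seq c c') s t s'" "Q t s'" unfolding runs_def by blast
  then show "runs c s (\<lambda>t s'. runs c' s' (\<lambda>t' s''. Q (t + t') s''))"
    by cases (auto simp: runs_def)
qed (auto simp: runs_def intro: exec.Seq)

lemma runs_Cond [simp]:
  "runs (Cond b c c') s Q \<longleftrightarrow> runs (if bval b s then c else c') s (\<lambda>t s'. Q (1 + bcost b + t) s')"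
proof
  assume "runs (Cond b c c') s Q"
  then obtain t s' where "exec (Cond b c c') s t s'" "Q t s'" unfolding runs_def by blast
  then show "runs (if bval b s then c else c') s (\<lambda>t s'. Q (1 + bcost b + t) s')"
    by cases (auto simp: runs_def)
qed (unfold runs_def, metis exec.CondT exec.CondF)

section \<open>Frame conditions read off the program text\<close>

primrec nwritten :: "com \<Rightarrow> string set" where
  "nwritten Skip = {}"
| "nwritten (NSet a e f) = {a}"
| "nwritten (RSet a e f) = {}"
| "nwritten (Seq c c') = nwritten c \<union> nwritten c'"
| "nwritten (Cond b c c') = nwritten c \<union> nwritten c'"
| "nwritten (While b c) = nwritten c"

primrec rwritten :: "com \<Rightarrow> string set" where
  "rwritten Skip = {}"
| "rwritten (NSet a e f) = {}"
| "rwritten (RSet a e f) = {a}"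
| "rwritten (Seq c c') = rwritten c \<union> rwritten c'"
| "rwritten (Cond b c c') = rwritten c \<union> rwritten c'"
| "rwritten (While b c) = rwritten c"

definition frame :: "com \<Rightarrow> store \<Rightarrow> store \<Rightarrow> bool" where
  "frame c s s' \<longleftrightarrow> (\<forall>a. a \<notin> nwritten c \<longrightarrow> nmem s' a = nmem s a) \<and>
     (\<forall>a. a \<notin> rwritten c \<longrightarrow> rmem s' a = rmem s a)"

lemma nmem_nwrite [simp]: "nmem (nwrite a i v s) = (nmem s)(a := (nmem s a)(i := v))"
  and rmem_nwrite [simp]: "rmem (nwrite a i v s) = rmem s"
  by (simp_all add: nwrite_def)

lemma nmem_rwrite [simp]: "nmem (rwrite a i v s) = nmem s"
  and rmem_rwrite [simp]: "rmem (rwrite a i v s) = (rmem s)(a := (rmem s a)(i := v))"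
  by (simp_all add: rwrite_def)

lemma exec_frame: "exec c s t s' \<Longrightarrow> frame c s s'"
  by (induction rule: exec.induct) (auto simp: frame_def)

lemma frame_nmem: "frame c s s' \<Longrightarrow> a \<notin> nwritten c \<Longrightarrow> nmem s' a = nmem s a"
  and frame_rmem: "frame c s s' \<Longrightarrow> a \<notin> rwritten c \<Longrightarrow> rmem s' a = rmem s a"
  by (auto simp: frame_def)

lemma frame_refl [simp]: "frame c s s"
  by (simp add: frame_def)

lemma frame_trans: "frame c s s' \<Longrightarrow> frame c s' s'' \<Longrightarrow> frame c s s''"
  by (simp add: frame_def)

lemma runs_frame: "runs c s Q \<Longrightarrow> runs c s (\<lambda>t s'. Q t s' \<and> frame c s s')"
  unfolding runs_def using exec_frame by blast

text \<open>The parameter \<open>m\<close> of the invariant bounds the number of remaining iterations.\<close>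

lemma runs_While:
  assumes step: "\<And>m s'. I m s' \<Longrightarrow> bval b s' \<Longrightarrow> frame c s s' \<Longrightarrow>
      \<exists>m'. m = Suc m' \<and> runs c s' (\<lambda>t s''. t \<le> T \<and> I m' s'')"
    and "I m s"
  shows "runs (While b c) s (\<lambda>t s'. t \<le> m * (1 + bcost b + T) + (1 + bcost b) \<and>
      (\<exists>m'. I m' s') \<and> \<not> bval b s')"
proof -
  \<comment> \<open>The frame condition relative to the entry store \<open>s\<close> is carried
    through the induction, so every iteration can still use what held on entry.\<close>
  have "runs (While b c) s' (\<lambda>t s''. t \<le> m * (1 + bcost b + T) + (1 + bcost b) \<and>
      (\<exists>m'. I m' s'') \<and> \<not> bval b s'')" if "I m s'" "frame c s s'" for m s'
    using that
  proof (induction m arbitrary: s')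
    case 0
    then have "\<not> bval b s'" using step by fastforce
    then show ?case unfolding runs_def using exec.WhileF 0 by fastforce
  next
    case (Suc m)
    show ?case
    proof (cases "bval b s'")
      case False
      then show ?thesis unfolding runs_def using exec.WhileF Suc.prems by fastforce
    next
      case True
      from step[OF Suc.prems(1) True Suc.prems(2)] obtain t s1
        where t: "exec c s' t s1" "t \<le> T" "I m s1"
        unfolding runs_def by auto
      have "frame c s s1" using exec_frame[OF t(1)] Suc.prems(2) frame_trans by blast
      from Suc.IH[OF t(3) this] obtain t' s2
        where t': "exec (While b c) s1 t' s2" "t' \<le> m * (1 + bcost b + T) + (1 + bcost b)"
          "\<exists>m'. I m' s2" "\<not> bval b s2"
        unfolding runs_def by auto
      have "exec (While b c) s' (1 + bcost b + t + t') s2"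
        using exec.WhileT[OF True t(1) t'(1)] .
      moreover have "1 + bcost b + t + t' \<le> Suc m * (1 + bcost b + T) + (1 + bcost b)"
        using t(2) t'(2) by simp
      ultimately show ?thesis unfolding runs_def using t'(3,4) by blast
    qed
  qed
  with assms(2) show ?thesis by simp
qed

section \<open>Counting loops\<close>

abbreviation N0 :: "string \<Rightarrow> nexp" where "N0 a \<equiv> NGet a (NConst 0)"
abbreviation R0 :: "string \<Rightarrow> rexp" where "R0 a \<equiv> RGet a (NConst 0)"
abbreviation NSet0 :: "string \<Rightarrow> nexp \<Rightarrow> com" where "NSet0 a e \<equiv> NSet a (NConst 0) e"
abbreviation RSet0 :: "string \<Rightarrow> rexp \<Rightarrow> com" where "RSet0 a e \<equiv> RSet a (NConst 0) e"
abbreviation Incr :: "string \<Rightarrow> com" where "Incr a \<equiv> NSet0 a (NAdd (N0 a) (NConst 1))"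

definition For :: "string \<Rightarrow> string \<Rightarrow> com \<Rightarrow> com" where
  "For v u c = Seq (NSet0 v (NConst 0)) (While (NLess (N0 v) (N0 u)) (Seq c (Incr v)))"

lemma written_For [simp]:
  "nwritten (For v u c) = insert v (nwritten c)" "rwritten (For v u c) = rwritten c"
  by (auto simp: For_def)

text \<open>The 12 extra steps per round are 6 for the guard and 6 for the increment; the final 9
  pay for the initialisation and the failing guard. \<open>P\<close> describes the store at the loop
  head, hence after the counter has been advanced.\<close>

lemma runs_For:
  assumes u: "nmem s u 0 = N" and vu: "u \<noteq> v" "v \<notin> nwritten c" "u \<notin> nwritten c"
    and init: "P 0 (nwrite v 0 0 s)"
    and step: "\<And>r s'. r < N \<Longrightarrow> P r s' \<Longrightarrow> nmem s' v 0 = r \<Longrightarrow> frame (For v u c) s s' \<Longrightarrow>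
      runs c s' (\<lambda>t s''. t \<le> T \<and> P (Suc r) (nwrite v 0 (Suc r) s''))"
  shows "runs (For v u c) s (\<lambda>t s'. t \<le> N * (T + 12) + 9 \<and> P N s' \<and> frame (For v u c) s s')"
proof -
  let ?c = "Seq c (Incr v)" and ?s = "nwrite v 0 0 s"
  let ?I = "\<lambda>m s'. m + nmem s' v 0 = N \<and> P (nmem s' v 0) s'"
  have "runs (While (NLess (N0 v) (N0 u)) ?c) ?s (\<lambda>t s'. t \<le> N * (1 + 5 + (T + 6)) + (1 + 5) \<and>
      (\<exists>m'. ?I m' s') \<and> \<not> bval (NLess (N0 v) (N0 u)) s' \<and> frame ?c ?s s')"
  proof -
    have "runs (While (NLess (N0 v) (N0 u)) ?c) ?s (\<lambda>t s'. t \<le> N * (1 + bcost (NLess (N0 v) (N0 u))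
      + (T + 6)) + (1 + bcost (NLess (N0 v) (N0 u))) \<and>
      (\<exists>m'. ?I m' s') \<and> \<not> bval (NLess (N0 v) (N0 u)) s')"
    proof (rule runs_While)
      show "?I N ?s" using init by simp
    next
      fix m s' assume I: "?I m s'" and b: "bval (NLess (N0 v) (N0 u)) s'" and fr: "frame ?c ?s s'"
      have "nmem s' u = nmem s u" using frame_nmem[OF fr, of u] vu by simp
      with b u have r: "nmem s' v 0 < N" by simp
      then obtain m' where m: "m = Suc m'" using I by (cases m) auto
      have fr': "frame (For v u c) s s'" using fr by (auto simp: frame_def)
      have "runs c s' (\<lambda>t s''. (t \<le> T \<and> P (Suc (nmem s' v 0)) (nwrite v 0 (Suc (nmem s' v 0)) s''))
         \<and> frame c s' s'')"
        by (rule runs_frame, rule step) (use I r fr' in auto)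
      then have "runs ?c s' (\<lambda>t s''. t \<le> T + 6 \<and> ?I m' s'')"
        unfolding runs_Seq runs_NSet
        by (rule runs_mono) (use I m vu in \<open>auto dest: frame_nmem\<close>)
      with m show "\<exists>m'. m = Suc m' \<and> runs ?c s' (\<lambda>t s''. t \<le> T + 6 \<and> ?I m' s'')" by blast
    qed
    from runs_frame[OF this] show ?thesis by (rule runs_mono) (simp add: frame_def)
  qed
  then show ?thesis unfolding For_def runs_Seq runs_NSet nval.simps
  proof (rule runs_mono, goal_cases)
    case (1 t s')
    then have fr: "frame ?c ?s s'" by blast
    then have "nmem s' u 0 = N" using frame_nmem[OF fr, of u] vu u by simp
    with 1 have "P (nmem s' v 0) s'" "nmem s' v 0 = N" by auto
    then have "P N s'" by simp
    moreover have "frame (For v u c) s s'" using fr by (auto simp: frame_def)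
    ultimately show ?case using 1 by (simp add: For_def algebra_simps)
  qed
qed

section \<open>Bottom-up merge sort\<close>

text \<open>Blocks are aligned at multiples of \<open>w\<close>, the last one cut off at
  \<open>m\<close>. The predicate is trivial for \<open>w = 1\<close> and means sortedness on
  \<open>{..<m}\<close> once \<open>w\<close> reaches \<open>m\<close>.\<close>

definition sorted_blocks :: "nat \<Rightarrow> nat \<Rightarrow> (nat \<Rightarrow> real) \<Rightarrow> bool" where
  "sorted_blocks w m f \<longleftrightarrow> (\<forall>a b. a \<le> b \<longrightarrow> b < m \<longrightarrow> a div w = b div w \<longrightarrow> f a \<le> f b)"

text \<open>
  The blocks \<open>{lo..<mid}\<close> and \<open>{mid..<hi}\<close> of \<open>A\<close> are being merged into \<open>{lo..<hi}\<close> of \<open>B\<close>; the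
  positions below \<open>i\<close> of the first and below \<open>j\<close> of the second block have been consumed, and
  \<open>q\<close> is the next position to be written.
\<close>

definition merge_inv ::
  "nat \<Rightarrow> (nat \<Rightarrow> real) \<Rightarrow> nat \<Rightarrow> (nat \<Rightarrow> nat) \<Rightarrow> (nat \<Rightarrow> nat) \<Rightarrow> nat \<Rightarrow> nat \<Rightarrow> nat \<Rightarrow> nat \<Rightarrow> nat \<Rightarrow> bool"
where
  "merge_inv n K w A B i mid j hi q \<longleftrightarrow>
     i \<le> mid \<and> mid \<le> j \<and> j \<le> hi \<and> hi \<le> n \<and> q + mid = i + j \<and>
     B ` {..<q} = A ` ({..<i} \<union> {mid..<j}) \<and> sorted_blocks (2 * w) q (K \<circ> B) \<and>
     (\<exists>lo. 2 * w dvd lo \<and> lo \<le> i \<and> mid = min (lo + w) n \<and> hi = min (lo + 2 * w) n \<and>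
        (\<forall>a\<in>{lo..<q}. \<forall>b\<in>{i..<mid} \<union> {j..<hi}. K (B a) \<le> K (A b)))"

lemma merge_inv_init: "merge_inv n K w A B 0 (min w n) (min w n) (min (2 * w) n) 0"
  by (auto simp: merge_inv_def sorted_blocks_def intro!: exI[of _ 0])

text \<open>At \<open>q = hi\<close> the count \<open>q + mid = i + j\<close> forces
  \<open>i = mid\<close> and \<open>j = hi\<close>: both blocks are used up and the next pair starts
  at \<open>q\<close>.\<close>

lemma merge_inv_next_block:
  assumes "merge_inv n K w A B i mid j q q" "q < n"
  shows "merge_inv n K w A B q (min (q + w) n) (min (q + w) n) (min (q + 2 * w) n) q"
proof -
  from assms obtain lo where lo: "2 * w dvd lo" "q = min (lo + 2 * w) n" "i \<le> mid" "mid \<le> j" "j \<le> q"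
      "q + mid = i + j"
    and B: "B ` {..<q} = A ` ({..<i} \<union> {mid..<j})" "sorted_blocks (2 * w) q (K \<circ> B)"
    unfolding merge_inv_def by blast
  have "j = q" "i = mid" using lo by auto
  then have "{..<i} \<union> {mid..<j} = {..<q}" using lo by auto
  \<comment> \<open>Since \<open>q < n\<close>, the old pair was not truncated and
    \<open>q = lo + 2 * w\<close>.\<close>
  moreover have "2 * w dvd q" using lo assms(2) by (auto simp: min_def split: if_splits)
  ultimately show ?thesis using B assms(2) unfolding merge_inv_def by (auto intro!: exI[of _ q])
qed

lemma div_eq_of_mem_block:
  fixes a w lo :: nat
  assumes "w dvd lo" "lo \<le> a" "a < lo + w"
  shows "a div w = lo div w"
proof -
  obtain k where k: "lo = w * k" using assms(1) by blast
  then have "w * k \<le> a" "a < w * k + w" using assms by auto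
  then have "a div w = k" by (intro div_nat_eqI) (auto simp: algebra_simps)
  then show ?thesis using k assms by auto
qed

text \<open>As \<open>lo\<close> is a multiple of \<open>w\<close> and at most \<open>q\<close>, the
  block of \<open>q\<close> has no position below \<open>lo\<close>, so the new entry need only
  dominate those from \<open>lo\<close> on.\<close>

lemma sorted_blocks_Suc:
  assumes "sorted_blocks w q (K \<circ> B)" "w dvd lo" "lo \<le> q" "\<And>a. lo \<le> a \<Longrightarrow> a < q \<Longrightarrow> K (B a) \<le> K c"
  shows "sorted_blocks w (Suc q) (K \<circ> B(q := c))"
  unfolding sorted_blocks_def
proof (intro allI impI)
  fix a b assume ab: "a \<le> b" "b < Suc q" "a div w = b div w"
  show "(K \<circ> B(q := c)) a \<le> (K \<circ> B(q := c)) b"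
  proof (cases "b = q \<and> a \<noteq> q")
    case True
    have "lo = lo div w * w" using assms(2) by simp
    also have "\<dots> \<le> q div w * w" using assms(3) by (intro mult_right_mono div_le_mono) auto
    also have "\<dots> = a div w * w" using True ab by simp
    also have "\<dots> \<le> a" by simp
    finally show ?thesis using True assms(4) ab by auto
  next
    case False
    then show ?thesis using ab assms(1) unfolding sorted_blocks_def by (cases "b = q") auto
  qed
qed

lemma image_upd_lessThan_Suc: "(f(q := c)) ` {..<Suc q} = insert c (f ` {..<q})"
  by (auto simp: lessThan_Suc image_iff)

text \<open>\<open>A i\<close> has the least key of all unconsumed entries: in its own block by
  sortedness, in the other because it does not exceed the head \<open>A j\<close>.\<close>

lemma merge_inv_left:
  assumes inv: "merge_inv n K w A B i mid j hi q" and A: "sorted_blocks w n (K \<circ> A)"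
    and i: "i < mid" "j < hi \<Longrightarrow> K (A i) \<le> K (A j)"
  shows "merge_inv n K w A (B(q := A i)) (Suc i) mid j hi (Suc q)"
proof -
  from inv obtain lo where lo: "2 * w dvd lo" "lo \<le> i" "mid = min (lo + w) n"
      "hi = min (lo + 2 * w) n" "mid \<le> j" "j \<le> hi" "q + mid = i + j"
    and B: "B ` {..<q} = A ` ({..<i} \<union> {mid..<j})" "sorted_blocks (2 * w) q (K \<circ> B)"
    and le: "\<forall>a\<in>{lo..<q}. \<forall>b\<in>{i..<mid} \<union> {j..<hi}. K (B a) \<le> K (A b)"
    unfolding merge_inv_def by (elim conjE exE)
  have w: "w dvd lo" "w dvd lo + w" using lo(1) by auto
  have 1: "K (A i) \<le> K (A b)" if "b \<in> {i..<mid}" for b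
  proof -
    have "i div w = b div w"
      using div_eq_of_mem_block[OF w(1), of i] div_eq_of_mem_block[OF w(1), of b] that lo by auto
    then show ?thesis using A that lo unfolding sorted_blocks_def by auto
  qed
  have 2: "K (A i) \<le> K (A b)" if b: "b \<in> {j..<hi}" for b
  proof -
    \<comment> \<open>A nonempty rest of the second block shows that \<open>mid\<close> was not
      truncated at \<open>n\<close>, so this block is aligned.\<close>
    have "mid = lo + w" using b lo by auto
    then have "j div w = b div w"
      using div_eq_of_mem_block[OF w(2), of j] div_eq_of_mem_block[OF w(2), of b] b lo by auto
    then have "K (A j) \<le> K (A b)" using A b lo unfolding sorted_blocks_def by auto
    then show ?thesis using i(2) b by auto
  qed
  have q: "lo \<le> q" using lo i by auto
  have "sorted_blocks (2 * w) (Suc q) (K \<circ> B(q := A i))"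
    by (rule sorted_blocks_Suc[OF B(2) lo(1) q]) (use le i in auto)
  moreover have "(B(q := A i)) ` {..<Suc q} = A ` ({..<Suc i} \<union> {mid..<j})"
    using B(1) by (simp only: image_upd_lessThan_Suc) (simp add: lessThan_Suc image_Un)
  moreover have "\<forall>a\<in>{lo..<Suc q}. \<forall>b\<in>{Suc i..<mid} \<union> {j..<hi}. K ((B(q := A i)) a) \<le> K (A b)"
    using le 1 2 by (auto simp: less_Suc_eq)
  ultimately show ?thesis unfolding merge_inv_def using lo i by (auto intro!: exI[of _ lo])
qed

text \<open>Mirror image of \<open>merge_inv_left\<close>. Both comparisons are non-strict, so ties
  may go either way.\<close>

lemma merge_inv_right:
  assumes inv: "merge_inv n K w A B i mid j hi q" and A: "sorted_blocks w n (K \<circ> A)"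
    and j: "j < hi" "i < mid \<Longrightarrow> K (A j) \<le> K (A i)"
  shows "merge_inv n K w A (B(q := A j)) i mid (Suc j) hi (Suc q)"
proof -
  from inv obtain lo where lo: "2 * w dvd lo" "lo \<le> i" "mid = min (lo + w) n" "i \<le> mid"
      "hi = min (lo + 2 * w) n" "mid \<le> j" "j \<le> hi" "q + mid = i + j"
    and B: "B ` {..<q} = A ` ({..<i} \<union> {mid..<j})" "sorted_blocks (2 * w) q (K \<circ> B)"
    and le: "\<forall>a\<in>{lo..<q}. \<forall>b\<in>{i..<mid} \<union> {j..<hi}. K (B a) \<le> K (A b)"
    unfolding merge_inv_def by (elim conjE exE)
  have w: "w dvd lo" "w dvd lo + w" using lo(1) by auto
  have 1: "K (A j) \<le> K (A b)" if b: "b \<in> {i..<mid}" for b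
  proof -
    have "i div w = b div w"
      using div_eq_of_mem_block[OF w(1), of i] div_eq_of_mem_block[OF w(1), of b] that lo by auto
    then have "K (A i) \<le> K (A b)" using A that lo unfolding sorted_blocks_def by auto
    then show ?thesis using j(2) b by auto
  qed
  have 2: "K (A j) \<le> K (A b)" if b: "b \<in> {j..<hi}" for b
  proof -
    have "mid = lo + w" using b lo by auto
    then have "j div w = b div w"
      using div_eq_of_mem_block[OF w(2), of j] div_eq_of_mem_block[OF w(2), of b] b lo by auto
    then show ?thesis using A b lo unfolding sorted_blocks_def by auto
  qed
  have q: "lo \<le> q" using lo by auto
  have "sorted_blocks (2 * w) (Suc q) (K \<circ> B(q := A j))"
    by (rule sorted_blocks_Suc[OF B(2) lo(1) q]) (use le j in auto)
  moreover have "(B(q := A j)) ` {..<Suc q} = A ` ({..<i} \<union> {mid..<Suc j})"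
    using B(1) lo(6) by (simp only: image_upd_lessThan_Suc) (simp add: image_Un atLeastLessThanSuc)
  moreover have "\<forall>a\<in>{lo..<Suc q}. \<forall>b\<in>{i..<mid} \<union> {Suc j..<hi}. K ((B(q := A j)) a) \<le> K (A b)"
    using le 1 2 by (auto simp: less_Suc_eq)
  ultimately show ?thesis unfolding merge_inv_def using lo j by (auto intro!: exI[of _ lo])
qed

text \<open>At \<open>q = n\<close> the count forces \<open>i = mid\<close> and
  \<open>j = n\<close>, so every position has been consumed.\<close>

lemma merge_inv_final:
  assumes "merge_inv n K w A B i mid j hi n"
  shows "B ` {..<n} = A ` {..<n}" "sorted_blocks (2 * w) n (K \<circ> B)"
proof -
  have *: "i \<le> mid" "mid \<le> j" "j \<le> hi" "hi \<le> n" "n + mid = i + j"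
    "B ` {..<n} = A ` ({..<i} \<union> {mid..<j})" "sorted_blocks (2 * w) n (K \<circ> B)"
    using assms unfolding merge_inv_def by auto
  then have "{..<i} \<union> {mid..<j} = {..<n}" by auto
  with * show "B ` {..<n} = A ` {..<n}" "sorted_blocks (2 * w) n (K \<circ> B)" by auto
qed

section \<open>The sorting program\<close>

text \<open>With truncated subtraction, \<open>a - (a - b)\<close> is the minimum of \<open>a\<close> and \<open>b\<close>.\<close>

abbreviation NMin :: "nexp \<Rightarrow> nexp \<Rightarrow> nexp" where "NMin e f \<equiv> NSub e (NSub e f)"

text \<open>The cells \<open>i\<close>, \<open>m\<close>, \<open>j\<close>, \<open>h\<close> hold
  \<open>i\<close>, \<open>mid\<close>, \<open>j\<close>, \<open>hi\<close> of
  \<open>merge_inv\<close>. The old end \<open>h\<close> is the start of the next pair and is saved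
  in \<open>i\<close> before being overwritten.\<close>

definition next_block :: com where
  "next_block =
     Seq (NSet0 ''i'' (N0 ''h''))
    (Seq (NSet0 ''m'' (NMin (NAdd (N0 ''i'') (N0 ''w'')) (N0 ''n'')))
    (Seq (NSet0 ''j'' (N0 ''m''))
         (NSet0 ''h'' (NMin (NAdd (N0 ''i'') (NAdd (N0 ''w'') (N0 ''w''))) (N0 ''n'')))))"

text \<open>Each step writes one cell of \<open>B\<close> and opens a new pair when needed, so a
  single loop over \<open>q\<close> does a whole pass in linear time. Keys stay in place in
  \<open>K\<close>; only indices move.\<close>

definition merge_step :: com where
  "merge_step =
     Seq (Cond (NLess (N0 ''q'') (N0 ''h'')) Skip next_block)
         (Cond (Conj (NLess (N0 ''i'') (N0 ''m'')) (Neg (Conj (NLess (N0 ''j'') (N0 ''h''))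
             (RLess (RGet ''K'' (NGet ''A'' (N0 ''j''))) (RGet ''K'' (NGet ''A'' (N0 ''i'')))))))
           (Seq (NSet ''B'' (N0 ''q'') (NGet ''A'' (N0 ''i''))) (Incr ''i''))
           (Seq (NSet ''B'' (N0 ''q'') (NGet ''A'' (N0 ''j''))) (Incr ''j'')))"

definition merge_pass :: com where
  "merge_pass =
     Seq (NSet0 ''h'' (NConst 0)) (Seq next_block
    (Seq (For ''q'' ''n'' merge_step)
    (Seq (For ''r'' ''n'' (NSet ''A'' (N0 ''r'') (NGet ''B'' (N0 ''r''))))
         (NSet0 ''w'' (NAdd (N0 ''w'') (N0 ''w''))))))"

definition merge_sort :: com where
  "merge_sort = Seq (NSet0 ''w'' (NConst 1)) (While (NLess (N0 ''w'') (N0 ''n'')) merge_pass)"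

abbreviation merge_state :: "nat \<Rightarrow> (nat \<Rightarrow> real) \<Rightarrow> nat \<Rightarrow> (nat \<Rightarrow> nat) \<Rightarrow> nat \<Rightarrow> store \<Rightarrow> bool" where
  "merge_state n K w A q s \<equiv> merge_inv n K w A (nmem s ''B'')
     (nmem s ''i'' 0) (nmem s ''m'' 0) (nmem s ''j'' 0) (nmem s ''h'' 0) q"

section \<open>Correctness and cost of the sort\<close>

lemma diff_diff_min: "a - (a - b) = min a (b :: nat)"
  by simp

text \<open>If the current pair is used up, \<open>next_block\<close> restores the invariant with
  room left; then one choice extends the output. The bound 100 covers 46 steps of
  \<open>next_block\<close>, at most 40 of choosing, and the guard.\<close>

lemma runs_merge_step:
  assumes "merge_state n K w A q s" "q < n" "nmem s ''n'' 0 = n" "nmem s ''w'' 0 = w"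
    "nmem s ''q'' 0 = q" "nmem s ''A'' = A" "rmem s ''K'' = K" "sorted_blocks w n (K \<circ> A)" "0 < w"
  shows "runs merge_step s (\<lambda>t s'. t \<le> 100 \<and> merge_state n K w A (Suc q) s')"
proof -
  let ?b = "Cond (Conj (NLess (N0 ''i'') (N0 ''m'')) (Neg (Conj (NLess (N0 ''j'') (N0 ''h''))
             (RLess (RGet ''K'' (NGet ''A'' (N0 ''j''))) (RGet ''K'' (NGet ''A'' (N0 ''i'')))))))
           (Seq (NSet ''B'' (N0 ''q'') (NGet ''A'' (N0 ''i''))) (Incr ''i''))
           (Seq (NSet ''B'' (N0 ''q'') (NGet ''A'' (N0 ''j''))) (Incr ''j''))"
  have pick: "runs ?b s' (\<lambda>t s'. t \<le> 40 \<and> merge_state n K w A (Suc q) s')"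
    if s': "merge_state n K w A q s'" "q < nmem s' ''h'' 0"
      "nmem s' ''q'' 0 = q" "nmem s' ''A'' = A" "rmem s' ''K'' = K" for s'
  proof (cases "nmem s' ''i'' 0 < nmem s' ''m'' 0 \<and>
      \<not> (nmem s' ''j'' 0 < nmem s' ''h'' 0 \<and> K (A (nmem s' ''j'' 0)) < K (A (nmem s' ''i'' 0)))")
    case True
    then have "merge_inv n K w A ((nmem s' ''B'')(q := A (nmem s' ''i'' 0))) (Suc (nmem s' ''i'' 0))
        (nmem s' ''m'' 0) (nmem s' ''j'' 0) (nmem s' ''h'' 0) (Suc q)"
      by (intro merge_inv_left[OF s'(1) assms(8)]) auto
    with True s' show ?thesis by simp
  next
    case False
    \<comment> \<open>If the left block is used up, then \<open>i = mid\<close>, hence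
      \<open>j = q\<close>, which is below \<open>h\<close>; otherwise the failed test itself says
      \<open>j < h\<close>.\<close>
    have "q + nmem s' ''m'' 0 = nmem s' ''i'' 0 + nmem s' ''j'' 0" "nmem s' ''i'' 0 \<le> nmem s' ''m'' 0"
      using s'(1) by (simp_all add: merge_inv_def)
    with False s'(2) have "nmem s' ''j'' 0 < nmem s' ''h'' 0" by auto
    then have "merge_inv n K w A ((nmem s' ''B'')(q := A (nmem s' ''j'' 0))) (nmem s' ''i'' 0)
        (nmem s' ''m'' 0) (Suc (nmem s' ''j'' 0)) (nmem s' ''h'' 0) (Suc q)"
      using False by (intro merge_inv_right[OF s'(1) assms(8)]) auto
    with False s' show ?thesis by auto
  qed
  show ?thesis
  proof (cases "q < nmem s ''h'' 0")
    case True
    then have "runs ?b s (\<lambda>t s'. t \<le> 40 \<and> merge_state n K w A (Suc q) s')"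
      using assms by (intro pick)
    then have "runs ?b s (\<lambda>t s'. 7 + t \<le> 100 \<and> merge_state n K w A (Suc q) s')"
      by (rule runs_mono) simp
    with True assms(5) show ?thesis unfolding merge_step_def runs_Seq
      by (subst runs_Cond) simp
  next
    case False
    have "q \<le> nmem s ''h'' 0" using assms(1) by (auto simp: merge_inv_def)
    with False have h: "nmem s ''h'' 0 = q" by simp
    have "runs next_block s (\<lambda>t s'. t \<le> 46 \<and> merge_state n K w A q s' \<and> q < nmem s' ''h'' 0 \<and>
      nmem s' ''q'' 0 = q \<and> nmem s' ''A'' = A \<and> rmem s' ''K'' = K)"
      using merge_inv_next_block[OF assms(1)[unfolded h] assms(2)] h assms
      by (simp add: next_block_def diff_diff_min mult_2 del: diff_diff_cancel)
    then have "runs (Seq next_block ?b) s (\<lambda>t s'. 6 + t \<le> 100 \<and> merge_state n K w A (Suc q) s')"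
      unfolding runs_Seq
    proof (rule runs_mono, goal_cases)
      case (1 t s')
      then have "runs ?b s' (\<lambda>t s'. t \<le> 40 \<and> merge_state n K w A (Suc q) s')" by (intro pick) auto
      then show ?case by (rule runs_mono) (use 1 in auto)
    qed
    with False assms(5) show ?thesis unfolding merge_step_def runs_Seq
      by (subst runs_Cond) (simp add: add.assoc)
  qed
qed

lemma written_merge_step [simp]:
  "nwritten merge_step = {''i'', ''m'', ''j'', ''h'', ''B''}" "rwritten merge_step = {}"
  by (auto simp: merge_step_def next_block_def)

lemma written_merge_pass [simp]:
  "nwritten merge_pass = {''i'', ''m'', ''j'', ''h'', ''B'', ''q'', ''r'', ''A'', ''w''}"
  "rwritten merge_pass = {}"
  by (auto simp: merge_pass_def next_block_def)

lemma written_merge_sort [simp]: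
  "nwritten merge_sort = {''i'', ''m'', ''j'', ''h'', ''B'', ''q'', ''r'', ''A'', ''w''}"
  "rwritten merge_sort = {}"
  by (auto simp: merge_sort_def)

lemma runs_merge_pass:
  assumes s: "nmem s ''n'' 0 = n" "nmem s ''w'' 0 = w" "rmem s ''K'' = K" "nmem s ''A'' = A"
    and A: "sorted_blocks w n (K \<circ> A)" "0 < w"
  shows "runs merge_pass s (\<lambda>t s'. t \<le> n * 150 + 100 \<and> nmem s' ''w'' 0 = 2 * w \<and>
    sorted_blocks (2 * w) n (K \<circ> nmem s' ''A'') \<and> nmem s' ''A'' ` {..<n} = A ` {..<n})"
proof -
  let ?copy = "NSet ''A'' (N0 ''r'') (NGet ''B'' (N0 ''r''))"
  have init: "runs next_block (nwrite ''h'' 0 0 s) (\<lambda>t s1. t \<le> 46 \<and> merge_state n K w A 0 s1 \<and>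
      nmem s1 ''n'' 0 = n \<and> nmem s1 ''w'' 0 = w \<and> nmem s1 ''A'' = A \<and> rmem s1 ''K'' = K)"
    using s merge_inv_init[of n K w A "nmem s ''B''"]
    by (simp add: next_block_def diff_diff_min mult_2 del: diff_diff_cancel)
  have merge: "runs (For ''q'' ''n'' merge_step) s1 (\<lambda>t s2. t \<le> n * (100 + 12) + 9 \<and>
      merge_state n K w A n s2 \<and> frame (For ''q'' ''n'' merge_step) s1 s2)"
    if s1: "merge_state n K w A 0 s1" "nmem s1 ''n'' 0 = n" "nmem s1 ''w'' 0 = w"
      "nmem s1 ''A'' = A" "rmem s1 ''K'' = K" for s1
  proof (rule runs_For[where P = "merge_state n K w A"])
    fix q s' assume *: "q < n" "merge_state n K w A q s'" "nmem s' ''q'' 0 = q"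
      and fr: "frame (For ''q'' ''n'' merge_step) s1 s'"
    have "nmem s' ''n'' = nmem s1 ''n''" "nmem s' ''w'' = nmem s1 ''w''" "nmem s' ''A'' = nmem s1 ''A''"
      "rmem s' ''K'' = rmem s1 ''K''"
      using fr by (simp_all add: frame_nmem frame_rmem)
    then have "runs merge_step s' (\<lambda>t s''. t \<le> 100 \<and> merge_state n K w A (Suc q) s'')"
      using * s1 A by (intro runs_merge_step) simp_all
    then show "runs merge_step s' (\<lambda>t s''. t \<le> 100 \<and>
        merge_state n K w A (Suc q) (nwrite ''q'' 0 (Suc q) s''))"
      by simp
  qed (use s1 in simp_all)
  have copy: "runs (For ''r'' ''n'' ?copy) s2 (\<lambda>t s3. t \<le> n * (10 + 12) + 9 \<and>
      (\<forall>a<n. nmem s3 ''A'' a = nmem s2 ''B'' a) \<and> frame (For ''r'' ''n'' ?copy) s2 s3)"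
    if "nmem s2 ''n'' 0 = n" for s2
  proof (rule runs_For[where P = "\<lambda>r s'. \<forall>a<r. nmem s' ''A'' a = nmem s2 ''B'' a"])
    fix r s' assume *: "\<forall>a<r. nmem s' ''A'' a = nmem s2 ''B'' a" "nmem s' ''r'' 0 = r"
      and fr: "frame (For ''r'' ''n'' ?copy) s2 s'"
    have "nmem s' ''B'' = nmem s2 ''B''"
      using fr by (simp_all add: frame_nmem)
    then show "runs ?copy s' (\<lambda>t s''. t \<le> 10 \<and>
        (\<forall>a<Suc r. nmem (nwrite ''r'' 0 (Suc r) s'') ''A'' a = nmem s2 ''B'' a))"
      using * by (simp add: less_Suc_eq)
  qed (use that in simp_all)
  show ?thesis
    unfolding merge_pass_def runs_Seq runs_NSet nval.simps
  proof (rule runs_mono[OF init], rule runs_mono[OF merge], goal_cases)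
    case (6 t1 s1 t2 s2)
    then have "frame (For ''q'' ''n'' merge_step) s1 s2" by blast
    then have fr: "nmem s2 ''n'' = nmem s1 ''n''" "nmem s2 ''w'' = nmem s1 ''w''"
      by (simp_all add: frame_nmem)
    show ?case
    proof (rule runs_mono[OF copy], goal_cases)
      case 1
      then show ?case using 6 fr by simp
    next
      case (2 t3 s3)
      then have "frame (For ''r'' ''n'' ?copy) s2 s3" by blast
      then have w: "nmem s3 ''w'' = nmem s2 ''w''" by (simp add: frame_nmem)
      have "merge_state n K w A n s2" using 6 by blast
      note B = merge_inv_final[OF this]
      have A3: "nmem s3 ''A'' a = nmem s2 ''B'' a" if "a < n" for a using 2 that by blast
      have "sorted_blocks (2 * w) n (K \<circ> nmem s3 ''A'')"
        using B(2) unfolding sorted_blocks_def by (simp add: A3)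
      moreover have "nmem s3 ''A'' ` {..<n} = A ` {..<n}" using B(1) A3 by simp
      ultimately show ?case using 6 2 fr w by simp
    qed
  qed blast+
qed

text \<open>After \<open>e\<close> passes the width is \<open>2 ^ e\<close>, so at most
  \<open>M\<close> passes run, each with 6 steps for the guard on top of its own cost.\<close>

lemma runs_merge_sort:
  assumes s: "nmem s ''n'' 0 = n" "rmem s ''K'' = K" "nmem s ''A'' = A" and M: "n \<le> 2 ^ M"
  shows "runs merge_sort s (\<lambda>t s'. t \<le> M * (n * 150 + 106) + 9 \<and>
    nmem s' ''A'' ` {..<n} = A ` {..<n} \<and>
    (\<forall>a b. a \<le> b \<longrightarrow> b < n \<longrightarrow> K (nmem s' ''A'' a) \<le> K (nmem s' ''A'' b)))"
proof -
  let ?b = "NLess (N0 ''w'') (N0 ''n'')" and ?s = "nwrite ''w'' 0 1 s"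
  let ?I = "\<lambda>m s'. \<exists>e. m + e = M \<and> nmem s' ''w'' 0 = 2 ^ e \<and>
    sorted_blocks (2 ^ e) n (K \<circ> nmem s' ''A'') \<and> nmem s' ''A'' ` {..<n} = A ` {..<n}"
  have "runs (While ?b merge_pass) ?s (\<lambda>t s'. t \<le> M * (1 + bcost ?b + (n * 150 + 100)) +
    (1 + bcost ?b) \<and> (\<exists>m'. ?I m' s') \<and> \<not> bval ?b s')"
  proof (rule runs_While)
    show "?I M ?s" using s by (auto intro!: exI[of _ 0] simp: sorted_blocks_def)
  next
    fix m s' assume "?I m s'" and b: "bval ?b s'" and fr: "frame merge_pass ?s s'"
    then obtain e where e: "m + e = M" "nmem s' ''w'' 0 = 2 ^ e"
      "sorted_blocks (2 ^ e) n (K \<circ> nmem s' ''A'')" "nmem s' ''A'' ` {..<n} = A ` {..<n}"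
      by blast
    have n: "nmem s' ''n'' 0 = n" "rmem s' ''K'' = K"
      using frame_nmem[OF fr, of "''n''"] frame_rmem[OF fr, of "''K''"] s by simp_all
    \<comment> \<open>The guard says \<open>2 ^ e < n\<close>, so the budget of \<open>M\<close>
      passes is not exhausted.\<close>
    with b e(2) M have "(2::nat) ^ e < 2 ^ M" by (simp del: power_strict_increasing_iff)
    then have "e < M" by simp
    then obtain m' where m: "m = Suc m'" using e(1) by (cases m) auto
    have "runs merge_pass s' (\<lambda>t s''. t \<le> n * 150 + 100 \<and> nmem s'' ''w'' 0 = 2 * 2 ^ e \<and>
      sorted_blocks (2 * 2 ^ e) n (K \<circ> nmem s'' ''A'') \<and>
      nmem s'' ''A'' ` {..<n} = nmem s' ''A'' ` {..<n})"
      by (rule runs_merge_pass) (use e n in simp_all)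
    then have "runs merge_pass s' (\<lambda>t s''. t \<le> n * 150 + 100 \<and> ?I m' s'')"
      by (rule runs_mono) (use e m in \<open>auto intro!: exI[of _ "Suc e"]\<close>)
    with m show "\<exists>m'. m = Suc m' \<and> runs merge_pass s' (\<lambda>t s''. t \<le> n * 150 + 100 \<and> ?I m' s'')"
      by blast
  qed
  from runs_frame[OF this] show ?thesis
    unfolding merge_sort_def runs_Seq runs_NSet nval.simps
  proof (rule runs_mono, goal_cases)
    case (1 t s')
    then obtain e where e: "nmem s' ''w'' 0 = 2 ^ e"
      "sorted_blocks (2 ^ e) n (K \<circ> nmem s' ''A'')" "nmem s' ''A'' ` {..<n} = A ` {..<n}"
      by blast
    have "frame merge_pass ?s s'" if "frame (While ?b merge_pass) ?s s'"
      using that by (simp add: frame_def)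
    then have "nmem s' ''n'' = nmem s ''n''" using 1 frame_nmem[of merge_pass ?s s' "''n''"] by auto
    then have "n \<le> 2 ^ e" using 1 e(1) s by simp
    \<comment> \<open>All positions below \<open>n\<close> now lie in block 0.\<close>
    then have "K (nmem s' ''A'' a) \<le> K (nmem s' ''A'' b)" if "a \<le> b" "b < n" for a b
      using e(2) that unfolding sorted_blocks_def by simp
    with 1 e(3) show ?case by (simp add: algebra_simps)
  qed
qed

section \<open>Preprocessing\<close>

text \<open>\<open>\<pi>\<close> lists the rows by rank, \<open>\<xi>\<close> their values. A map of
  the finite set \<open>{..<n}\<close> onto itself is a permutation, so it suffices that sorting
  preserves images.\<close>

definition sorted_column ::
  "nat \<Rightarrow> (nat \<Rightarrow> real) \<Rightarrow> (nat \<Rightarrow> nat) \<Rightarrow> (nat \<Rightarrow> real) \<Rightarrow> bool" where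
  "sorted_column n v \<pi> \<xi> \<longleftrightarrow> \<pi> ` {..<n} = {..<n} \<and> (\<forall>r<n. \<xi> r = v (\<pi> r)) \<and>
     (\<forall>a b. a \<le> b \<longrightarrow> b < n \<longrightarrow> v (\<pi> a) \<le> v (\<pi> b))"

lemma sorted_column_cong:
  assumes "sorted_column n v \<pi> \<xi>" "\<And>i. i < n \<Longrightarrow> v' i = v i"
    "\<And>r. r < n \<Longrightarrow> \<pi>' r = \<pi> r" "\<And>r. r < n \<Longrightarrow> \<xi>' r = \<xi> r"
  shows "sorted_column n v' \<pi>' \<xi>'"
proof -
  have "\<pi>' ` {..<n} = \<pi> ` {..<n}" using assms(3) by auto
  moreover have "\<pi> r < n" if "r < n" for r using assms(1) that unfolding sorted_column_def by blast
  ultimately show ?thesis using assms unfolding sorted_column_def by simp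
qed

text \<open>
  Rank \<open>r\<close> of column \<open>k\<close> is stored at \<open>p = k * n + r\<close>: its row index in \<open>P\<close> and its value in \<open>X\<close>.
  Only addition being available, \<open>p\<close> and the input address \<open>o = r * d + k\<close> are updated incrementally.
\<close>

definition load_column :: com where
  "load_column =
     Seq (NSet ''A'' (N0 ''r'') (N0 ''r''))
    (Seq (RSet ''K'' (N0 ''r'') (RGet ''x'' (N0 ''o'')))
         (NSet0 ''o'' (NAdd (N0 ''o'') (N0 ''d''))))"

definition store_column :: com where
  "store_column =
     Seq (NSet ''P'' (N0 ''p'') (NGet ''A'' (N0 ''r'')))
    (Seq (RSet ''X'' (N0 ''p'') (RGet ''K'' (NGet ''A'' (N0 ''r''))))
         (Incr ''p''))"

definition sort_column :: com where
  "sort_column =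
     Seq (NSet0 ''o'' (N0 ''k''))
    (Seq (For ''r'' ''n'' load_column)
    (Seq merge_sort
         (For ''r'' ''n'' store_column)))"

definition prep :: com where
  "prep = For ''k'' ''d'' sort_column"

lemma written_column [simp]:
  "nwritten load_column = {''A'', ''o''}" "rwritten load_column = {''K''}"
  "nwritten store_column = {''P'', ''p''}" "rwritten store_column = {''X''}"
  by (auto simp: load_column_def store_column_def)

lemma written_sort_column [simp]:
  "nwritten sort_column =
     {''A'', ''o'', ''r'', ''i'', ''m'', ''j'', ''h'', ''B'', ''q'', ''w'', ''P'', ''p''}"
  "rwritten sort_column = {''K'', ''X''}"
  by (auto simp: sort_column_def)

text \<open>Cells below \<open>k * n\<close> belong to earlier columns and stay unchanged, and
  \<open>p\<close> ends where the next column begins. The term with \<open>M\<close> is the sort;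
  the rest pays for loading and storing.\<close>

lemma runs_sort_column:
  assumes s: "nmem s ''n'' 0 = n" "nmem s ''d'' 0 = d" "nmem s ''k'' 0 = k" "nmem s ''p'' 0 = k * n"
    and v: "\<And>i. i < n \<Longrightarrow> rmem s ''x'' (i * d + k) = v i" and M: "n \<le> 2 ^ M"
  shows "runs sort_column s (\<lambda>t s'. t \<le> M * (n * 150 + 106) + n * 200 + 100 \<and>
    nmem s' ''p'' 0 = Suc k * n \<and>
    (\<forall>q<k * n. nmem s' ''P'' q = nmem s ''P'' q \<and> rmem s' ''X'' q = rmem s ''X'' q) \<and>
    sorted_column n v (\<lambda>r. nmem s' ''P'' (k * n + r)) (\<lambda>r. rmem s' ''X'' (k * n + r)))"
proof -
  \<comment> \<open>The address \<open>o\<close> walks down column \<open>k\<close> of the row-major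
    input with stride \<open>d\<close>.\<close>
  let ?L = "\<lambda>r s'. nmem s' ''o'' 0 = k + r * d \<and>
    (\<forall>i<r. nmem s' ''A'' i = i \<and> rmem s' ''K'' i = v i)"
  have load: "runs (For ''r'' ''n'' load_column) (nwrite ''o'' 0 k s)
      (\<lambda>t s1. t \<le> n * (30 + 12) + 9 \<and> ?L n s1 \<and>
      frame (For ''r'' ''n'' load_column) (nwrite ''o'' 0 k s) s1)"
  proof (rule runs_For[where P = "?L"])
    fix r s' assume *: "r < n" "?L r s'" "nmem s' ''r'' 0 = r"
      and fr: "frame (For ''r'' ''n'' load_column) (nwrite ''o'' 0 k s) s'"
    have "nmem s' ''d'' 0 = d" "rmem s' ''x'' (k + r * d) = v r"
      using s v[OF *(1)] by (simp_all add: frame_nmem[OF fr] frame_rmem[OF fr] add.commute)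
    then show "runs load_column s' (\<lambda>t s''. t \<le> 30 \<and> ?L (Suc r) (nwrite ''r'' 0 (Suc r) s''))"
      using * by (simp add: load_column_def less_Suc_eq)
  qed (use s in simp_all)
  let ?S = "\<lambda>s2 r s'. nmem s' ''p'' 0 = k * n + r \<and>
    (\<forall>q<k * n. nmem s' ''P'' q = nmem s2 ''P'' q \<and> rmem s' ''X'' q = rmem s2 ''X'' q) \<and>
    (\<forall>a<r. nmem s' ''P'' (k * n + a) = nmem s2 ''A'' a \<and>
      rmem s' ''X'' (k * n + a) = rmem s2 ''K'' (nmem s2 ''A'' a))"
  have store: "runs (For ''r'' ''n'' store_column) s2 (\<lambda>t s3. t \<le> n * (30 + 12) + 9 \<and> ?S s2 n s3 \<and>
      frame (For ''r'' ''n'' store_column) s2 s3)"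
    if s2: "nmem s2 ''n'' 0 = n" "nmem s2 ''p'' 0 = k * n" for s2
  proof (rule runs_For[where P = "?S s2"])
    fix r s' assume *: "?S s2 r s'" "nmem s' ''r'' 0 = r"
      and fr: "frame (For ''r'' ''n'' store_column) s2 s'"
    have "nmem s' ''A'' = nmem s2 ''A''" "rmem s' ''K'' = rmem s2 ''K''"
      by (simp_all add: frame_nmem[OF fr] frame_rmem[OF fr])
    then show "runs store_column s' (\<lambda>t s''. t \<le> 30 \<and> ?S s2 (Suc r) (nwrite ''r'' 0 (Suc r) s''))"
      using * by (simp add: store_column_def less_Suc_eq)
  qed (use s2 in simp_all)
  show ?thesis
    unfolding sort_column_def runs_Seq runs_NSet nval.simps s(3)
  proof (rule runs_mono[OF load], goal_cases)
    case (1 t1 s1)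
    then have fr: "frame (For ''r'' ''n'' load_column) (nwrite ''o'' 0 k s) s1" by blast
    have s1: "nmem s1 ''n'' 0 = n" "nmem s1 ''p'' 0 = k * n" "nmem s1 ''P'' = nmem s ''P''"
      "rmem s1 ''X'' = rmem s ''X''"
      using s by (simp_all add: frame_nmem[OF fr] frame_rmem[OF fr])
    show ?case
    proof (rule runs_mono[OF runs_frame[OF runs_merge_sort[OF s1(1) refl refl M]]], goal_cases)
      case (1 t2 s2)
      then have fr2: "frame merge_sort s1 s2" by blast
      have s2: "nmem s2 ''n'' 0 = n" "nmem s2 ''p'' 0 = k * n" "nmem s2 ''P'' = nmem s ''P''"
        "rmem s2 ''X'' = rmem s ''X''" "rmem s2 ''K'' = rmem s1 ''K''"
        using s1 by (simp_all add: frame_nmem[OF fr2] frame_rmem[OF fr2])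
      have K: "rmem s1 ''K'' i = v i" "nmem s1 ''A'' i = i" if "i < n" for i
        using that \<open>t1 \<le> _ \<and> _\<close> by auto
      \<comment> \<open>The indices start as the identity, so the image kept by the sort is
        \<open>{..<n}\<close>.\<close>
      then have "nmem s1 ''A'' ` {..<n} = {..<n}" by auto
      with 1 have im: "nmem s2 ''A'' ` {..<n} = {..<n}" by simp
      then have bnd: "nmem s2 ''A'' r < n" if "r < n" for r using that by blast
      have col: "sorted_column n v (nmem s2 ''A'') (\<lambda>r. rmem s2 ''K'' (nmem s2 ''A'' r))"
        unfolding sorted_column_def
      proof (intro conjI allI impI)
        fix a b assume "a \<le> b" "b < n"
        with 1 have "rmem s1 ''K'' (nmem s2 ''A'' a) \<le> rmem s1 ''K'' (nmem s2 ''A'' b)" by blast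
        with \<open>a \<le> b\<close> \<open>b < n\<close> show "v (nmem s2 ''A'' a) \<le> v (nmem s2 ''A'' b)" by (simp add: K bnd)
      qed (simp_all add: im s2(5) K bnd)
      show ?case
      proof (rule runs_mono[OF store[OF s2(1,2)]], goal_cases)
        case (1 t3 s3)
        then have "sorted_column n v (\<lambda>r. nmem s3 ''P'' (k * n + r)) (\<lambda>r. rmem s3 ''X'' (k * n + r))"
          by (intro sorted_column_cong[OF col]) simp_all
        with 1 \<open>t1 \<le> _ \<and> _\<close> \<open>(t2 \<le> _ \<and> _) \<and> _\<close> s2 show ?case by (simp add: algebra_simps)
      qed
    qed
  qed
qed

lemma runs_prep:
  assumes M: "n \<le> 2 ^ M"
  shows "runs prep (input_store n d x) (\<lambda>t s. t \<le> d * (M * (n * 150 + 106) + n * 200 + 112) + 9 \<and>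
    nmem s ''n'' 0 = n \<and> nmem s ''d'' 0 = d \<and>
    (\<forall>k<d. sorted_column n (\<lambda>i. x i $ k)
      (\<lambda>r. nmem s ''P'' (k * n + r)) (\<lambda>r. rmem s ''X'' (k * n + r))))"
proof -
  let ?s = "input_store n d x"
  let ?S = "\<lambda>s k. sorted_column n (\<lambda>i. x i $ k)
      (\<lambda>r. nmem s ''P'' (k * n + r)) (\<lambda>r. rmem s ''X'' (k * n + r))"
  let ?I = "\<lambda>k s. nmem s ''p'' 0 = k * n \<and> (\<forall>k'<k. ?S s k')"
  have s: "nmem ?s ''n'' 0 = n" "nmem ?s ''d'' 0 = d" "nmem ?s ''p'' 0 = 0"
    by (simp_all add: input_store_def)
  \<comment> \<open>The address is below \<open>n * d\<close>, so it holds an input entry and not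
    the default 0.\<close>
  have x: "rmem ?s ''x'' (i * d + k) = x i $ k" if "i < n" "k < d" for i k
  proof -
    have "i * d + k < Suc i * d" using that by simp
    also have "\<dots> \<le> n * d" using that by (intro mult_right_mono) auto
    finally show ?thesis using that by (simp add: input_store_def)
  qed
  have "runs prep ?s (\<lambda>t s'. t \<le> d * ((M * (n * 150 + 106) + n * 200 + 100) + 12) + 9 \<and> ?I d s' \<and>
    frame (For ''k'' ''d'' sort_column) ?s s')"
    unfolding prep_def
  proof (rule runs_For[where P = "?I"])
    fix k s' assume *: "k < d" "?I k s'" "nmem s' ''k'' 0 = k"
      and fr: "frame (For ''k'' ''d'' sort_column) ?s s'"
    have s': "nmem s' ''n'' 0 = n" "nmem s' ''d'' 0 = d"
      "\<And>i. i < n \<Longrightarrow> rmem s' ''x'' (i * d + k) = x i $ k"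
      using s x * by (simp_all add: frame_nmem[OF fr] frame_rmem[OF fr])
    show "runs sort_column s' (\<lambda>t s''. t \<le> M * (n * 150 + 106) + n * 200 + 100 \<and>
        ?I (Suc k) (nwrite ''k'' 0 (Suc k) s''))"
    proof (rule runs_mono[OF runs_sort_column[OF s'(1,2) *(3) _ s'(3) M]], goal_cases)
      case (3 t s'')
      have "?S s'' k'" if "k' < k" for k'
      proof (rule sorted_column_cong)
        show "?S s' k'" using * that by blast
        \<comment> \<open>An earlier column ends before cell \<open>k * n\<close>, so storing column
          \<open>k\<close> leaves it alone.\<close>
        have "k' * n + r < k * n" if "r < n" for r
        proof -
          have "k' * n + r < Suc k' * n" using that by simp
          also have "\<dots> \<le> k * n" using \<open>k' < k\<close> by (intro mult_right_mono) auto
          finally show ?thesis .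
        qed
        then show "nmem s'' ''P'' (k' * n + r) = nmem s' ''P'' (k' * n + r)"
          "rmem s'' ''X'' (k' * n + r) = rmem s' ''X'' (k' * n + r)" if "r < n" for r
          using 3 that by simp_all
      qed simp
      with 3 show ?case by (simp add: less_Suc_eq)
    qed (use * in simp_all)
  qed (use s in simp_all)
  then show ?thesis
  proof (rule runs_mono, goal_cases)
    case (1 t s')
    then have "frame (For ''k'' ''d'' sort_column) ?s s'" by blast
    then have "nmem s' ''n'' 0 = n" "nmem s' ''d'' 0 = d" using s by (simp_all add: frame_nmem)
    with 1 show ?case by (simp add: algebra_simps)
  qed
qed

section \<open>Queries\<close>

text \<open>For \<open>v i = x i $ k\<close> this is the share of coordinate \<open>k\<close> in
  entry \<open>i\<close> of the product, by \<open>tv_eq_sum_max\<close>.\<close>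

definition column_term :: "nat \<Rightarrow> (nat \<Rightarrow> real) \<Rightarrow> (nat \<Rightarrow> real) \<Rightarrow> nat \<Rightarrow> real" where
  "column_term n v y i = (\<Sum>j<n. max 0 (v i - v j) * y j)"

lemma sorted_column_inj: "sorted_column n v \<pi> \<xi> \<Longrightarrow> inj_on \<pi> {..<n}"
  unfolding sorted_column_def by (intro eq_card_imp_inj_on) simp_all

text \<open>Rows of rank at least \<open>r\<close> have values at least \<open>v (\<pi> r)\<close>
  and drop out; for smaller ranks the maximum is the difference itself. Ties contribute 0 either
  way.\<close>

lemma column_term_sorted:
  assumes "sorted_column n v \<pi> \<xi>" "r < n"
  shows "column_term n v y (\<pi> r) = \<xi> r * (\<Sum>a<r. y (\<pi> a)) - (\<Sum>a<r. \<xi> a * y (\<pi> a))"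
proof -
  have im: "\<pi> ` {..<n} = {..<n}" and \<xi>: "\<And>a. a < n \<Longrightarrow> \<xi> a = v (\<pi> a)"
    and mono: "\<And>a b. a \<le> b \<Longrightarrow> b < n \<Longrightarrow> v (\<pi> a) \<le> v (\<pi> b)"
    using assms(1) unfolding sorted_column_def by auto
  have "column_term n v y (\<pi> r) = (\<Sum>j\<in>\<pi> ` {..<n}. max 0 (v (\<pi> r) - v j) * y j)"
    unfolding column_term_def im ..
  also have "\<dots> = (\<Sum>a<n. max 0 (v (\<pi> r) - v (\<pi> a)) * y (\<pi> a))"
    using sorted_column_inj[OF assms(1)] by (simp add: sum.reindex)
  also have "\<dots> = (\<Sum>a<r. max 0 (v (\<pi> r) - v (\<pi> a)) * y (\<pi> a))"
    using assms(2) mono by (intro sum.mono_neutral_right) auto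
  also have "\<dots> = (\<Sum>a<r. \<xi> r * y (\<pi> a) - \<xi> a * y (\<pi> a))"
    using assms(2) mono \<xi> by (intro sum.cong) (auto simp: algebra_simps)
  finally show ?thesis by (simp add: sum_subtractf sum_distrib_left)
qed

text \<open>\<open>out\<close> is updated before \<open>V\<close> and \<open>Y\<close> take in the
  current row, so both are sums over strictly smaller ranks, as in
  \<open>column_term_sorted\<close>.\<close>

definition scan_step :: com where
  "scan_step =
     Seq (RSet ''out'' (NGet ''P'' (N0 ''p''))
       (RSub (RAdd (RGet ''out'' (NGet ''P'' (N0 ''p''))) (RMul (RGet ''X'' (N0 ''p'')) (R0 ''Y''))) (R0 ''V'')))
    (Seq (RSet0 ''V''
       (RAdd (R0 ''V'') (RMul (RGet ''X'' (N0 ''p'')) (RGet ''y'' (NGet ''P'' (N0 ''p''))))))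
    (Seq (RSet0 ''Y'' (RAdd (R0 ''Y'') (RGet ''y'' (NGet ''P'' (N0 ''p'')))))
         (Incr ''p'')))"

definition scan_column :: com where
  "scan_column =
     Seq (RSet0 ''Y'' (RConst 0))
    (Seq (RSet0 ''V'' (RConst 0))
         (For ''r'' ''n'' scan_step))"

text \<open>Clearing \<open>out\<close> makes the result independent of what earlier queries left
  behind; the tables \<open>P\<close> and \<open>X\<close> are only read.\<close>

definition query :: com where
  "query =
     Seq (For ''r'' ''n'' (RSet ''out'' (N0 ''r'') (RConst 0)))
    (Seq (NSet0 ''p'' (NConst 0))
         (For ''k'' ''d'' scan_column))"

lemma written_query [simp]:
  "nwritten scan_step = {''p''}" "rwritten scan_step = {''out'', ''V'', ''Y''}"
  "nwritten scan_column = {''r'', ''p''}" "rwritten scan_column = {''out'', ''V'', ''Y''}"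
  "nwritten query = {''r'', ''p'', ''k''}" "rwritten query = {''out'', ''V'', ''Y''}"
  by (auto simp: scan_step_def scan_column_def query_def)

lemma runs_scan_column:
  assumes s: "nmem s ''n'' 0 = n" "nmem s ''p'' 0 = k * n"
    and col: "sorted_column n v (\<lambda>r. nmem s ''P'' (k * n + r)) (\<lambda>r. rmem s ''X'' (k * n + r))"
  shows "runs scan_column s (\<lambda>t s'. t \<le> n * 62 + 20 \<and> nmem s' ''p'' 0 = Suc k * n \<and>
    (\<forall>i<n. rmem s' ''out'' i = rmem s ''out'' i + column_term n v (rmem s ''y'') i))"
proof -
  define \<pi> \<xi> where "\<pi> = (\<lambda>r. nmem s ''P'' (k * n + r))" and "\<xi> = (\<lambda>r. rmem s ''X'' (k * n + r))"
  let ?y = "rmem s ''y''"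
  have col: "sorted_column n v \<pi> \<xi>" using assms(3) by (simp add: \<pi>_def \<xi>_def)
  let ?s = "rwrite ''V'' 0 0 (rwrite ''Y'' 0 0 s)"
  let ?I = "\<lambda>r s'. nmem s' ''p'' 0 = k * n + r \<and> rmem s' ''Y'' 0 = (\<Sum>a<r. ?y (\<pi> a)) \<and>
    rmem s' ''V'' 0 = (\<Sum>a<r. \<xi> a * ?y (\<pi> a)) \<and>
    (\<forall>i. rmem s' ''out'' i = rmem s ''out'' i +
      (if i \<in> \<pi> ` {..<r} then column_term n v ?y i else 0))"
  have loop: "runs (For ''r'' ''n'' scan_step) ?s (\<lambda>t s'. t \<le> n * (50 + 12) + 9 \<and> ?I n s' \<and>
    frame (For ''r'' ''n'' scan_step) ?s s')"
  proof (rule runs_For[where P = "?I"])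
    fix r s' assume *: "r < n" "?I r s'" "nmem s' ''r'' 0 = r"
      and fr: "frame (For ''r'' ''n'' scan_step) ?s s'"
    have s': "nmem s' ''P'' (k * n + r) = \<pi> r" "rmem s' ''X'' (k * n + r) = \<xi> r" "rmem s' ''y'' = ?y"
      by (simp_all add: frame_nmem[OF fr] frame_rmem[OF fr] \<pi>_def \<xi>_def)
    have inv: "nmem s' ''p'' 0 = k * n + r" "rmem s' ''Y'' 0 = (\<Sum>a<r. ?y (\<pi> a))"
      "rmem s' ''V'' 0 = (\<Sum>a<r. \<xi> a * ?y (\<pi> a))"
      and out: "\<And>i. rmem s' ''out'' i = rmem s ''out'' i +
        (if i \<in> \<pi> ` {..<r} then column_term n v ?y i else 0)"
      using *(2) by simp_all
    have "\<pi> r \<noteq> \<pi> a" if "a < r" for a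
      using inj_onD[OF sorted_column_inj[OF col], of r a] that *(1) by auto
    then have new: "\<pi> r \<notin> \<pi> ` {..<r}" by blast
    have "((rmem s' ''out'')(\<pi> r := rmem s' ''out'' (\<pi> r) +
        \<xi> r * (\<Sum>a<r. ?y (\<pi> a)) - (\<Sum>a<r. \<xi> a * ?y (\<pi> a)))) i =
      rmem s ''out'' i + (if i \<in> \<pi> ` {..<Suc r} then column_term n v ?y i else 0)" for i
    proof (cases "i = \<pi> r")
      case True
      then show ?thesis using out[of i] new column_term_sorted[OF col *(1), of ?y] by simp
    next
      case False
      then show ?thesis using out[of i] by (simp add: lessThan_Suc)
    qed
    then show "runs scan_step s' (\<lambda>t s''. t \<le> 50 \<and> ?I (Suc r) (nwrite ''r'' 0 (Suc r) s''))"
      using inv s' *(3) by (simp add: scan_step_def del: fun_upd_apply)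
        (simp add: fun_upd_apply split del: if_split)
  qed (use s in simp_all)
  have im: "\<pi> ` {..<n} = {..<n}" using col unfolding sorted_column_def by (rule conjunct1)
  show ?thesis
    unfolding scan_column_def runs_Seq runs_RSet nval.simps rval.simps of_int_0
  proof (rule runs_mono[OF loop], goal_cases)
    case (1 t s')
    note inv = 1[THEN conjunct2, THEN conjunct1]
    note out = inv[THEN conjunct2, THEN conjunct2, THEN conjunct2, THEN spec]
    have "\<forall>i<n. rmem s' ''out'' i = rmem s ''out'' i + column_term n v ?y i"
      unfolding out im by simp
    with 1[THEN conjunct1] inv[THEN conjunct1] show ?case by simp
  qed
qed

lemma runs_query:
  assumes s: "nmem s ''n'' 0 = n" "nmem s ''d'' 0 = d"
    and col: "\<And>k. k < d \<Longrightarrow> sorted_column n (v k)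
      (\<lambda>r. nmem s ''P'' (k * n + r)) (\<lambda>r. rmem s ''X'' (k * n + r))"
  shows "runs query s (\<lambda>t s'. t \<le> d * (n * 62 + 32) + n * 20 + 30 \<and>
    (\<forall>i<n. rmem s' ''out'' i = (\<Sum>k<d. column_term n (v k) (rmem s ''y'') i)))"
proof -
  let ?clear = "RSet ''out'' (N0 ''r'') (RConst 0)"
  let ?y = "rmem s ''y''"
  have clear: "runs (For ''r'' ''n'' ?clear) s (\<lambda>t s1. t \<le> n * (5 + 12) + 9 \<and>
    (\<forall>i<n. rmem s1 ''out'' i = 0) \<and> frame (For ''r'' ''n'' ?clear) s s1)"
    by (rule runs_For[where P = "\<lambda>r s'. \<forall>i<r. rmem s' ''out'' i = 0"])
      (use s in \<open>simp_all add: less_Suc_eq\<close>)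
  let ?I = "\<lambda>k s'. nmem s' ''p'' 0 = k * n \<and>
    (\<forall>i<n. rmem s' ''out'' i = (\<Sum>k'<k. column_term n (v k') ?y i))"
  have scan: "runs (For ''k'' ''d'' scan_column) s1 (\<lambda>t s'. t \<le> d * ((n * 62 + 20) + 12) + 9 \<and>
      ?I d s' \<and> frame (For ''k'' ''d'' scan_column) s1 s')"
    if s1: "nmem s1 ''n'' 0 = n" "nmem s1 ''d'' 0 = d" "nmem s1 ''p'' 0 = 0"
      "nmem s1 ''P'' = nmem s ''P''" "rmem s1 ''X'' = rmem s ''X''" "rmem s1 ''y'' = ?y"
      "\<forall>i<n. rmem s1 ''out'' i = 0" for s1
  proof (rule runs_For[where P = "?I"])
    fix k s' assume *: "k < d" "?I k s'" "nmem s' ''k'' 0 = k"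
      and fr: "frame (For ''k'' ''d'' scan_column) s1 s'"
    have s': "nmem s' ''n'' 0 = n" "nmem s' ''P'' = nmem s ''P''" "rmem s' ''X'' = rmem s ''X''"
      "rmem s' ''y'' = ?y"
      using s1 by (simp_all add: frame_nmem[OF fr] frame_rmem[OF fr])
    show "runs scan_column s' (\<lambda>t s''. t \<le> n * 62 + 20 \<and> ?I (Suc k) (nwrite ''k'' 0 (Suc k) s''))"
      by (rule runs_mono[OF runs_scan_column[where v = "v k" and n = n and k = k]])
        (use * s' col in simp_all)
  qed (use s1 in simp_all)
  show ?thesis
    unfolding query_def runs_Seq runs_NSet nval.simps
  proof (rule runs_mono[OF clear], goal_cases)
    case (1 t s1)
    then have fr: "frame (For ''r'' ''n'' ?clear) s s1" by blast
    show ?case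
      by (rule runs_mono[OF scan])
        (use 1 s in \<open>simp_all add: frame_nmem[OF fr] frame_rmem[OF fr] algebra_simps\<close>)
  qed
qed

section \<open>Correctness and running time\<close>

text \<open>Since \<open>max 0 z = (\<bar>z\<bar> + z) / 2\<close>, the two sides differ by half the
  difference of the total masses, and both masses are 1.\<close>

lemma tv_eq_sum_max:
  assumes "prob_vec d p" "prob_vec d q"
  shows "tv p q = (\<Sum>k<d. max 0 (p $ k - q $ k))"
proof -
  have "(\<Sum>k<d. max 0 (p $ k - q $ k)) = (\<Sum>k<d. (\<bar>p $ k - q $ k\<bar> + p $ k - q $ k) / 2)"
    by (intro sum.cong) (auto simp: max_def abs_if)
  also have "\<dots> = ((\<Sum>k<d. \<bar>p $ k - q $ k\<bar>) + (\<Sum>k<d. p $ k) - (\<Sum>k<d. q $ k)) / 2"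
    by (simp add: sum_divide_distrib [symmetric] sum.distrib sum_subtractf)
  finally show ?thesis using assms by (auto simp: tv_def prob_vec_def)
qed

text \<open>Exchanging the sums over rows and coordinates leaves one term per column, which is what
  the query accumulates.\<close>

lemma tv_matrix_mult:
  assumes x: "\<And>i. i < n \<Longrightarrow> prob_vec d (x i)" and y: "y \<in> carrier_vec n" and i: "i < n"
  shows "(tv_matrix n x *\<^sub>v y) $ i = (\<Sum>k<d. column_term n (\<lambda>i. x i $ k) (($) y) i)"
proof -
  have "(tv_matrix n x *\<^sub>v y) $ i = (\<Sum>j<n. tv (x i) (x j) * y $ j)"
    using y i by (simp add: tv_matrix_def scalar_prod_def atLeast0LessThan)
  also have "\<dots> = (\<Sum>j<n. \<Sum>k<d. max 0 (x i $ k - x j $ k) * y $ j)"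
    using x i by (simp add: tv_eq_sum_max[where d = d] sum_distrib_right)
  also have "\<dots> = (\<Sum>k<d. \<Sum>j<n. max 0 (x i $ k - x j $ k) * y $ j)"
    by (rule sum.swap)
  finally show ?thesis by (simp add: column_term_def)
qed

text \<open>Loading a query changes only \<open>y\<close>, and a run writes only names assigned in
  the program. Hence the tables survive any sequence of queries.\<close>

lemma after_queries_unchanged:
  assumes "after_queries c n s0 s"
  shows "a \<notin> nwritten c \<Longrightarrow> nmem s a = nmem s0 a"
    and "a \<notin> rwritten c \<Longrightarrow> a \<noteq> ''y'' \<Longrightarrow> rmem s a = rmem s0 a"
  using assms by (induction rule: after_queries.induct)
    (auto dest!: exec_frame simp: frame_def load_query_def)

text \<open>The exponent is the rounded-up logarithm. Rounding adds at most 1, which the factor 2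
  absorbs thanks to the \<open>max 1\<close>.\<close>

lemma ex_power2_bound:
  fixes n :: nat
  assumes "n \<ge> 1"
  obtains M :: nat where "n \<le> 2 ^ M" "real M \<le> 2 * max 1 (log 2 (real n))"
proof
  define M where "M = nat \<lceil>log 2 (real n)\<rceil>"
  have l: "log 2 (real n) \<ge> 0" using assms by simp
  then have M: "real M \<ge> log 2 (real n)" "real M \<le> log 2 (real n) + 1"
    unfolding M_def by linarith+
  have "real n = 2 powr log 2 (real n)" using assms by simp
  also have "\<dots> \<le> 2 powr real M" using M by (intro powr_mono) auto
  also have "\<dots> = real (2 ^ M)" by (simp add: powr_realpow)
  finally show "n \<le> 2 ^ M" by linarith
  show "real M \<le> 2 * max 1 (log 2 (real n))" using M by linarith
qed

theorem theorem19:
  "\<exists>(prep :: com) (query :: com) (C :: real).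
     \<forall>(n :: nat) (d :: nat) (x :: nat \<Rightarrow> real vec).
       n \<ge> 1 \<longrightarrow> (\<forall>i<n. prob_vec d (x i)) \<longrightarrow>
       (\<exists>t s\<^sub>0. exec prep (input_store n d x) t s\<^sub>0 \<and>
          real t \<le> C * (real n * real d * max 1 (log 2 (real n))) \<and>
          (\<forall>s (y :: real vec). after_queries query n s\<^sub>0 s \<longrightarrow> y \<in> carrier_vec n \<longrightarrow>
             (\<exists>t' s'. exec query (load_query y s) t' s' \<and>
                real t' \<le> C * (real n * real d) \<and>
                output_vec n s' = tv_matrix n x *\<^sub>v y)))"
proof (rule exI[of _ prep], rule exI[of _ query], rule exI[of _ 1000], intro allI impI)
  fix n d :: nat and x :: "nat \<Rightarrow> real vec"
  assume n: "1 \<le> n" and x: "\<forall>i<n. prob_vec d (x i)"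
  then have "prob_vec d (x 0)" by simp
  \<comment> \<open>An empty domain would have total mass 0. As \<open>n\<close> and
    \<open>d\<close> are both positive, all lower-order terms are bounded by
    \<open>n * d\<close>.\<close>
  then have d: "1 \<le> d" unfolding prob_vec_def by (cases d) auto
  have nd: "n \<le> n * d" "d \<le> n * d" "1 \<le> n * d" using n d by auto
  let ?L = "max 1 (log 2 (real n))"
  obtain M where M: "n \<le> 2 ^ M" "real M \<le> 2 * ?L" using ex_power2_bound[OF n] .
  obtain t s0 where prep: "exec prep (input_store n d x) t s0"
    and t: "t \<le> d * (M * (n * 150 + 106) + n * 200 + 112) + 9"
    and s0: "nmem s0 ''n'' 0 = n" "nmem s0 ''d'' 0 = d"
      "\<And>k. k < d \<Longrightarrow> sorted_column n (\<lambda>i. x i $ k)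
        (\<lambda>r. nmem s0 ''P'' (k * n + r)) (\<lambda>r. rmem s0 ''X'' (k * n + r))"
    using runs_prep[OF M(1), of d x] unfolding runs_def by auto
  have "d * (M * (n * 150 + 106) + n * 200 + 112) + 9 =
      150 * (n * d * M) + 106 * (d * M) + 200 * (n * d) + 112 * d + 9"
    by (simp add: algebra_simps)
  \<comment> \<open>\<open>256 = 150 + 106\<close> and \<open>321 = 200 + 112 + 9\<close>.\<close>
  also have "\<dots> \<le> 256 * (n * d * M) + 321 * (n * d)"
    using nd mult_right_mono[OF nd(2) le0, of M] by linarith
  finally have "real t \<le> real (256 * (n * d * M) + 321 * (n * d))" using t by linarith
  also have "\<dots> = real (n * d) * (256 * real M + 321 * 1)" by (simp add: algebra_simps)
  \<comment> \<open>The resulting factor \<open>512 + 321 = 833\<close> is below the chosen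
    1000.\<close>
  also have "\<dots> \<le> real (n * d) * (256 * (2 * ?L) + 321 * ?L)"
    using M(2) by (intro mult_left_mono add_mono) auto
  also have "\<dots> \<le> real (n * d) * (1000 * ?L)"
    by (intro mult_left_mono) auto
  finally have time: "real t \<le> 1000 * (real n * real d * ?L)" by (simp add: algebra_simps)
  have "\<exists>t' s'. exec query (load_query y s) t' s' \<and> real t' \<le> 1000 * (real n * real d) \<and>
      output_vec n s' = tv_matrix n x *\<^sub>v y"
    if s: "after_queries query n s0 s" and y: "y \<in> carrier_vec n" for s y
  proof -
    note unchanged = after_queries_unchanged[OF s]
    let ?s = "load_query y s"
    have "nmem ?s ''n'' 0 = n" "nmem ?s ''d'' 0 = d" "nmem ?s ''P'' = nmem s0 ''P''"
      "rmem ?s ''X'' = rmem s0 ''X''"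
      using s0 by (simp_all add: load_query_def unchanged)
    then obtain t' s' where q: "exec query ?s t' s'" "t' \<le> d * (n * 62 + 32) + n * 20 + 30"
      and out: "\<And>i. i < n \<Longrightarrow>
        rmem s' ''out'' i = (\<Sum>k<d. column_term n (\<lambda>i. x i $ k) (rmem ?s ''y'') i)"
      using runs_query[of ?s n d "\<lambda>k i. x i $ k"] s0(3) unfolding runs_def by auto
    have "d * (n * 62 + 32) + n * 20 + 30 = 62 * (n * d) + 32 * d + 20 * n + 30"
      by (simp add: algebra_simps)
    \<comment> \<open>The coefficients add up to 144.\<close>
    then have "t' \<le> 1000 * (n * d)" using q(2) nd by linarith
    then have "real t' \<le> 1000 * (real n * real d)" by (metis of_nat_le_iff of_nat_mult of_nat_numeral)
    moreover have "output_vec n s' = tv_matrix n x *\<^sub>v y"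
    proof (rule eq_vecI)
      fix i assume "i < dim_vec (tv_matrix n x *\<^sub>v y)"
      then have i: "i < n" by (simp add: tv_matrix_def)
      \<comment> \<open>The array \<open>y\<close> is known to agree with the query only below
        \<open>n\<close>, and \<open>column_term\<close> reads no further.\<close>
      have "column_term n v (rmem ?s ''y'') i = column_term n v (($) y) i" for v
        using y by (simp add: column_term_def load_query_def)
      then show "output_vec n s' $ i = (tv_matrix n x *\<^sub>v y) $ i"
        using i x y by (simp add: output_vec_def out tv_matrix_mult[where d = d])
    qed (simp add: output_vec_def tv_matrix_def)
    ultimately show ?thesis using q(1) by blast
  qed
  with prep time show "\<exists>t s\<^sub>0. exec prep (input_store n d x) t s\<^sub>0 \<and>
      real t \<le> 1000 * (real n * real d * max 1 (log 2 (real n))) \<and>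
      (\<forall>s (y :: real vec). after_queries query n s\<^sub>0 s \<longrightarrow> y \<in> carrier_vec n \<longrightarrow>
         (\<exists>t' s'. exec query (load_query y s) t' s' \<and>
            real t' \<le> 1000 * (real n * real d) \<and>
            output_vec n s' = tv_matrix n x *\<^sub>v y))"
    by blast
qed

end
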